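(* The binary operation $\star$ on the set of positive real numbers (defined in the context via the arithmetic-geometric mean $\mathrm{agm}$ and the theta function $\theta$) satisfies the following algebraic properties, where $a, x, y, z$ denote positive real numbers. (D) $a \star x = a \star y$ implies $x = y$ (a cancellation law). (E) $(ax) \star (ay) = a \star (a(x \star y))$ for any $a, x, y$ (a distributive law). (F) If $z = x \star y$, then $y = x\,(x^{-1} \star (x^{-1}z))$. In particular, the inverse of $x$ with respect to the operation $\star$ is $x\,(x^{-1} \star x^{-1})$. Here juxtaposition denotes ordinary multiplication and $x^{-1} = 1/x$ is the ordinary reciprocal.
   Context: For positive real numbers $x, y$, the arithmetic-geometric mean $\mathrm{agm}(x,y)$ is defined as follows: put $x_0 = x$, $y_0 = y$, and $x_n = (x_{n-1}+y_{n-1})/2$, $y_n = \sqrt{x_{n-1}y_{n-1}}$ for $n \ge 1$; then $\mathrm{agm}(x,y) = \lim_{n\to\infty} x_n = \lim_{n\to\infty} y_n$ (the common limit, which is positive). For $-1 < q < 1$ let $\theta(q) = \sum_{n=-\infty}^{+\infty} q^{n^2} = 1 + 2\sum_{n=1}^{\infty} q^{n^2}$, and write $\theta^2(q)$ for $(\theta(q))^2$. The function $\theta$ is strictly increasing on $(-1,1)$, with $\lim_{q\to -1}\theta(q) = 0$, $\theta(0)=1$, $\lim_{q\to 1}\theta(q) = +\infty$. The operation $\star$ on the set of positive real numbers: for positive real $x, y$, let $q \in (-1,1)$ be the unique number such that $1/\mathrm{agm}(x,y) = \theta^2(q)$, and define $x \star y = \theta^2(-q)/\theta^2(q)$. (The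 operation is commutative, since $\mathrm{agm}(x,y)=\mathrm{agm}(y,x)$.) The number $1$ is the unit element of $\star$, and an inverse of $x$ with respect to $\star$ means a positive real number $y$ with $x \star y = 1$. *)

theory Defs
  imports "HOL-Analysis.Analysis"
begin

primrec agm_seq :: "real \<Rightarrow> real \<Rightarrow> nat \<Rightarrow> real \<times> real" where
  "agm_seq x y 0 = (x, y)"
| "agm_seq x y (Suc n) =
     ((fst (agm_seq x y n) + snd (agm_seq x y n)) / 2,
      sqrt (fst (agm_seq x y n) * snd (agm_seq x y n)))"

text \<open>For positive arguments both component sequences converge to the same limit, so choosing
  the first component is immaterial.\<close>

definition agm :: "real \<Rightarrow> real \<Rightarrow> real" where
  "agm x y = lim (\<lambda>n. fst (agm_seq x y n))"

text \<open>The sum ranges over all integers; it converges absolutely for \<open>-1 < q < 1\<close>, the only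
  range in which \<open>theta\<close> is used. At \<open>q = 0\<close> the term for \<open>n = 0\<close> is \<open>0 powi 0 = 1\<close>.\<close>

definition theta :: "real \<Rightarrow> real" where
  "theta q = (\<Sum>\<^sub>\<infinity>n::int. q powi (n\<^sup>2))"

text \<open>For positive \<open>x\<close> and \<open>y\<close> there is exactly one such \<open>q\<close>, because \<open>theta\<close> is a strictly
  increasing bijection from \<open>(-1, 1)\<close> onto the positive reals.\<close>

definition nome :: "real \<Rightarrow> real \<Rightarrow> real" where
  "nome x y = (THE q. q \<in> {-1<..<1} \<and> 1 / agm x y = (theta q)\<^sup>2)"

definition star :: "real \<Rightarrow> real \<Rightarrow> real"  (infixl \<open>\<star>\<close> 70) where
  "x \<star> y = (theta (- nome x y))\<^sup>2 / (theta (nome x y))\<^sup>2"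

definition star_inverse :: "real \<Rightarrow> real \<Rightarrow> bool" where
  "star_inverse x y \<longleftrightarrow> y > 0 \<and> x \<star> y = 1"

end

theory Submission
  imports Defs
begin

text \<open>
  The theta function parametrises the iteration of the arithmetic-geometric mean: by the classical
  identities \<open>theta_square_mean\<close> and \<open>theta_product_reflection\<close>, the arithmetic and geometric
  means of \<open>\<theta>\<^sup>2(q)\<close> and \<open>\<theta>\<^sup>2(-q)\<close> are \<open>\<theta>\<^sup>2(q\<^sup>2)\<close> and \<open>\<theta>\<^sup>2(-q\<^sup>2)\<close>. Iterating squares the nome each
  time, so the means tend to \<open>\<theta>\<^sup>2(0) = 1\<close>, that is, \<open>agm (\<theta>\<^sup>2(q)) (\<theta>\<^sup>2(-q)) = 1\<close> (\<open>agm_theta\<close>).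
  If \<open>q\<close> is the nome of \<open>x\<close> and \<open>y\<close>, dividing by \<open>\<theta>\<^sup>2(q) = 1 / agm x y\<close> and using homogeneity gives
  \<open>agm 1 (x \<star> y) = agm x y\<close>, and since \<open>agm\<close> is strictly increasing in each argument, \<open>x \<star> y\<close> is
  the only positive number with this property (\<open>star_eq_iff\<close>).

  This removes the theta function from the problem. Cancellation is the strict monotonicity of
  \<open>agm\<close>. For distributivity, both sides have the same \<open>agm\<close> with \<open>1\<close>, namely
  \<open>agm (a x) (a y) = a agm 1 (x \<star> y) = agm a (a (x \<star> y))\<close>. For the solution of \<open>z = x \<star> y\<close>,
  dividing \<open>agm 1 z = agm x y\<close> by \<open>x\<close> gives \<open>agm (1/x) (z/x) = agm 1 (y/x)\<close>, which
  says that \<open>(1/x) \<star> (z/x) = y/x\<close>; the inverse is the case \<open>z = 1\<close>.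

  It remains to see that the nome is well defined, that is, that \<open>\<theta>\<close> maps \<open>(-1, 1)\<close> bijectively
  onto the positive reals. On \<open>[0, 1)\<close> monotonicity and unboundedness are read off the series. On
  negative arguments, where the series alternates, they come from the two facts above:
  in \<open>agm (\<theta>\<^sup>2(q)) (\<theta>\<^sup>2(-q)) = 1\<close> one argument must decrease when the other increases, and
  \<open>\<theta>(q) \<theta>(-q) = \<theta>\<^sup>2(-q\<^sup>2) \<le> 1\<close> forces \<open>\<theta>(-q)\<close> to be small when \<open>\<theta>(q)\<close> is large.
\<close>

section \<open>The arithmetic-geometric mean\<close>

lemma agm_seq_Suc_shift:
  "agm_seq x y (Suc n) = agm_seq ((x + y) / 2) (sqrt (x * y)) n"
  by (induction n) simp_all

lemma agm_seq_pos:
  assumes "x > 0" "y > 0"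
  shows "fst (agm_seq x y n) > 0" and "snd (agm_seq x y n) > 0"
proof -
  have "fst (agm_seq x y n) > 0 \<and> snd (agm_seq x y n) > 0"
    using assms by (induction n) simp_all
  then show "fst (agm_seq x y n) > 0" and "snd (agm_seq x y n) > 0"
    by simp_all
qed

lemma agm_seq_snd_le_fst:
  assumes "x > 0" "y > 0"
  shows "snd (agm_seq x y (Suc n)) \<le> fst (agm_seq x y (Suc n))"
  using arith_geo_mean_sqrt[of "fst (agm_seq x y n)" "snd (agm_seq x y n)"]
    agm_seq_pos[OF assms, of n]
  by simp

lemma agm_seq_fst_decreasing:
  assumes "x > 0" "y > 0"
  shows "fst (agm_seq x y (Suc (Suc n))) \<le> fst (agm_seq x y (Suc n))"
proof -
  define u v where "u = fst (agm_seq x y (Suc n))" and "v = snd (agm_seq x y (Suc n))"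
  have "v \<le> u"
    using agm_seq_snd_le_fst[OF assms, of n] by (simp only: u_def v_def)
  then have "(u + v) / 2 \<le> u"
    by simp
  then show ?thesis
    by (simp only: agm_seq.simps(2)[of _ _ "Suc n"] fst_conv u_def v_def)
qed

lemma agm_seq_snd_increasing:
  assumes "x > 0" "y > 0"
  shows "snd (agm_seq x y (Suc n)) \<le> snd (agm_seq x y (Suc (Suc n)))"
proof -
  define u v where "u = fst (agm_seq x y (Suc n))" and "v = snd (agm_seq x y (Suc n))"
  have "0 < v" "v \<le> u"
    using agm_seq_pos[OF assms, of "Suc n"] agm_seq_snd_le_fst[OF assms, of n]
    by (simp_all only: u_def v_def)
  then have "sqrt (v * v) \<le> sqrt (u * v)"
    by (intro real_sqrt_le_mono mult_right_mono) simp_all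
  then have "v \<le> sqrt (u * v)"
    using \<open>0 < v\<close> by simp
  then show ?thesis
    by (simp only: agm_seq.simps(2)[of _ _ "Suc n"] snd_conv u_def v_def)
qed

text \<open>From the first step on, the arithmetic means decrease and stay above the geometric means,
  which increase; hence they converge to a limit no smaller than the first geometric mean.\<close>

lemma agm_limit:
  assumes "x > 0" "y > 0"
  shows "(\<lambda>n. fst (agm_seq x y n)) \<longlonglongrightarrow> agm x y" and "agm x y > 0"
proof -
  define c where "c = snd (agm_seq x y (Suc 0))"
  have lower: "c \<le> fst (agm_seq x y (Suc n))" for n
  proof -
    have "incseq (\<lambda>n. snd (agm_seq x y (Suc n)))"
      using agm_seq_snd_increasing[OF assms] by (rule incseq_SucI)
    then have "c \<le> snd (agm_seq x y (Suc n))"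
      unfolding c_def by (rule incseqD) simp
    then show ?thesis
      using agm_seq_snd_le_fst[OF assms, of n] by linarith
  qed
  have "decseq (\<lambda>n. fst (agm_seq x y (Suc n)))"
    using agm_seq_fst_decreasing[OF assms] by (rule decseq_SucI)
  then obtain L where shifted: "(\<lambda>n. fst (agm_seq x y (Suc n))) \<longlonglongrightarrow> L"
    using lower by (metis decseq_convergent)
  then have "c \<le> L"
    using lower by (intro LIMSEQ_le_const) auto
  from shifted have L: "(\<lambda>n. fst (agm_seq x y n)) \<longlonglongrightarrow> L"
    by (rule LIMSEQ_imp_Suc[of "\<lambda>n. fst (agm_seq x y n)"])
  then have "agm x y = L"
    unfolding agm_def by (rule limI)
  moreover have "c > 0"
    unfolding c_def by (rule agm_seq_pos(2)[OF assms])
  ultimately show "(\<lambda>n. fst (agm_seq x y n)) \<longlonglongrightarrow> agm x y" and "agm x y > 0"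
    using L \<open>c \<le> L\<close> by simp_all
qed

lemma agm_step:
  assumes "x > 0" "y > 0"
  shows "agm ((x + y) / 2) (sqrt (x * y)) = agm x y"
proof (rule LIMSEQ_unique)
  show "(\<lambda>n. fst (agm_seq x y (Suc n))) \<longlonglongrightarrow> agm ((x + y) / 2) (sqrt (x * y))"
    unfolding agm_seq_Suc_shift by (rule agm_limit(1)) (use assms in simp_all)
  show "(\<lambda>n. fst (agm_seq x y (Suc n))) \<longlonglongrightarrow> agm x y"
    using agm_limit(1)[OF assms] by (rule LIMSEQ_Suc)
qed

lemma agm_seq_scale:
  assumes "c > 0"
  shows "agm_seq (c * x) (c * y) n = (c * fst (agm_seq x y n), c * snd (agm_seq x y n))"
proof (induction n)
  case (Suc n)
  have "sqrt (c * u * (c * v)) = c * sqrt (u * v)" for u v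
  proof -
    have "c * u * (c * v) = c\<^sup>2 * (u * v)"
      by (simp add: power2_eq_square algebra_simps)
    then show ?thesis
      using assms by (simp add: real_sqrt_mult)
  qed
  then show ?case
    using Suc by (simp add: distrib_left)
qed simp

lemma agm_scale:
  assumes "c > 0" "x > 0" "y > 0"
  shows "agm (c * x) (c * y) = c * agm x y"
proof (rule LIMSEQ_unique)
  show "(\<lambda>n. fst (agm_seq (c * x) (c * y) n)) \<longlonglongrightarrow> agm (c * x) (c * y)"
    by (rule agm_limit(1)) (use assms in simp_all)
  show "(\<lambda>n. fst (agm_seq (c * x) (c * y) n)) \<longlonglongrightarrow> c * agm x y"
    unfolding agm_seq_scale[OF assms(1)] fst_conv
    by (intro tendsto_mult_left agm_limit(1) assms)
qed

lemma agm_seq_mono: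
  assumes "0 < x" "0 < y" "x \<le> x'" "y \<le> y'"
  shows "fst (agm_seq x y n) \<le> fst (agm_seq x' y' n) \<and> snd (agm_seq x y n) \<le> snd (agm_seq x' y' n)"
proof (induction n)
  case (Suc n)
  then show ?case
    using agm_seq_pos[OF assms(1,2), of n]
    by (auto intro!: real_sqrt_le_mono mult_mono intro: less_imp_le order_trans)
qed (use assms in simp)

lemma agm_mono:
  assumes "0 < x" "0 < y" "x \<le> x'" "y \<le> y'"
  shows "agm x y \<le> agm x' y'"
proof (rule LIMSEQ_le)
  show "(\<lambda>n. fst (agm_seq x y n)) \<longlonglongrightarrow> agm x y"
    using assms by (intro agm_limit)
  show "(\<lambda>n. fst (agm_seq x' y' n)) \<longlonglongrightarrow> agm x' y'"
    using assms by (intro agm_limit) linarith+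
qed (use agm_seq_mono[OF assms] in auto)

text \<open>Monotonicity alone could lose strictness in the limit. If both arguments grow, they grow at
  least by a common factor \<open>c > 1\<close>, and homogeneity carries that factor through.\<close>

lemma agm_less_of_both_less:
  assumes "0 < x" "0 < y" "x < x'" "y < y'"
  shows "agm x y < agm x' y'"
proof -
  define c where "c = min (x' / x) (y' / y)"
  have "c > 1" "c * x \<le> x'" "c * y \<le> y'"
    using assms by (auto simp: c_def min_def field_simps)
  have "agm x y < c * agm x y"
    using \<open>c > 1\<close> agm_limit(2)[OF assms(1,2)] by simp
  also have "\<dots> = agm (c * x) (c * y)"
    using \<open>c > 1\<close> assms by (simp add: agm_scale)
  also have "\<dots> \<le> agm x' y'"
    using \<open>c > 1\<close> \<open>c * x \<le> x'\<close> \<open>c * y \<le> y'\<close> assms by (intro agm_mono) simp_all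
  finally show ?thesis .
qed

text \<open>If only one argument grows, one step of the iteration makes both grow.\<close>

lemma agm_strict_mono:
  assumes "0 < x" "0 < y" "x \<le> x'" "y \<le> y'" "x < x' \<or> y < y'"
  shows "agm x y < agm x' y'"
proof -
  have "x * y < x' * y'"
    using assms by (auto intro: mult_less_le_imp_less mult_le_less_imp_less)
  moreover have "x + y < x' + y'"
    using assms by linarith
  ultimately have "agm ((x + y) / 2) (sqrt (x * y)) < agm ((x' + y') / 2) (sqrt (x' * y'))"
    using assms by (intro agm_less_of_both_less) simp_all
  then show ?thesis
    using assms by (simp add: agm_step)
qed

lemma agm_right_cancel:
  assumes "a > 0" "x > 0" "y > 0" "agm a x = agm a y"
  shows "x = y"
  using agm_strict_mono[of a x a y] agm_strict_mono[of a y a x] assms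
  by (cases x y rule: linorder_cases) auto

section \<open>The theta series\<close>

lemma theta_summable_nonneg:
  fixes r :: real
  assumes "0 \<le> r" "r < 1"
  shows "(\<lambda>n::int. r powi (n\<^sup>2)) summable_on UNIV"
proof -
  have "summable (\<lambda>n::nat. r ^ (n\<^sup>2))"
  proof (rule summable_comparison_test')
    show "summable (\<lambda>n. r ^ n)"
      using assms by (intro summable_geometric) simp
    show "norm (r ^ (n\<^sup>2)) \<le> r ^ n" for n
      using assms by (simp add: power_decreasing power2_eq_square)
  qed
  then have nat: "(\<lambda>n::nat. r ^ (n\<^sup>2)) summable_on UNIV"
    using assms by (simp add: summable_on_UNIV_nonneg_real_iff)
  have sq: "r powi ((int n)\<^sup>2) = r ^ (n\<^sup>2)" for n
    by (metis of_nat_power power_int_of_nat)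
  have "(\<lambda>n::int. r powi (n\<^sup>2)) summable_on range int"
    using nat by (subst summable_on_reindex) (simp_all add: o_def sq)
  moreover have "(\<lambda>n::int. r powi (n\<^sup>2)) summable_on range (\<lambda>n. - int n)"
    using nat by (subst summable_on_reindex) (simp_all add: o_def sq inj_on_def)
  moreover have "range int \<union> range (\<lambda>n. - int n) = UNIV"
    by (auto simp: image_iff) (metis int_cases2)
  ultimately show ?thesis
    using summable_on_union by metis
qed

lemma theta_has_sum:
  assumes "\<bar>q\<bar> < 1"
  shows "((\<lambda>n::int. q powi (n\<^sup>2)) has_sum theta q) UNIV"
proof -
  have "(\<lambda>n::int. norm (q powi (n\<^sup>2))) summable_on UNIV"
    using theta_summable_nonneg[of "\<bar>q\<bar>"] assms by (simp add: power_int_abs)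
  then show ?thesis
    unfolding theta_def by (rule has_sum_infsum[OF abs_summable_summable])
qed

lemma theta_product_has_sum:
  assumes "\<bar>q\<bar> < 1" "\<bar>r\<bar> < 1"
  shows "((\<lambda>(m::int, n::int). q powi (m\<^sup>2) * r powi (n\<^sup>2)) has_sum theta q * theta r) UNIV"
proof -
  have "(\<lambda>(m::int, n::int). \<bar>q\<bar> powi (m\<^sup>2) * \<bar>r\<bar> powi (n\<^sup>2)) summable_on UNIV \<times> UNIV"
  proof (rule summable_on_SigmaI)
    show "((\<lambda>n. case (m, n) of (m, n) \<Rightarrow> \<bar>q\<bar> powi (m\<^sup>2) * \<bar>r\<bar> powi (n\<^sup>2)) has_sum
        \<bar>q\<bar> powi (m\<^sup>2) * theta \<bar>r\<bar>) (UNIV :: int set)" for m :: int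
      using has_sum_cmult_right[OF theta_has_sum] assms by simp
    show "(\<lambda>m::int. \<bar>q\<bar> powi (m\<^sup>2) * theta \<bar>r\<bar>) summable_on UNIV"
      using assms by (intro summable_on_cmult_left theta_summable_nonneg) simp_all
  qed simp
  then have "(\<lambda>p::int \<times> int. norm (case p of (m, n) \<Rightarrow> q powi (m\<^sup>2) * r powi (n\<^sup>2)))
      summable_on UNIV \<times> UNIV"
    by (simp add: case_prod_unfold abs_mult power_int_abs)
  then have summable: "(\<lambda>p::int \<times> int. case p of (m, n) \<Rightarrow> q powi (m\<^sup>2) * r powi (n\<^sup>2))
      summable_on UNIV \<times> UNIV"
    by (rule abs_summable_summable)
  have "((\<lambda>p::int \<times> int. case p of (m, n) \<Rightarrow> q powi (m\<^sup>2) * r powi (n\<^sup>2))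
      has_sum theta q * theta r) (UNIV \<times> UNIV)"
  proof (rule has_sum_SigmaI)
    show "((\<lambda>n::int. case (m, n) of (m, n) \<Rightarrow> q powi (m\<^sup>2) * r powi (n\<^sup>2)) has_sum
        q powi (m\<^sup>2) * theta r) UNIV" for m :: int
      using has_sum_cmult_right[OF theta_has_sum] assms by simp
    show "((\<lambda>m::int. q powi (m\<^sup>2) * theta r) has_sum theta q * theta r) UNIV"
      using assms by (intro has_sum_cmult_left theta_has_sum)
  qed (rule summable)
  then show ?thesis
    by simp
qed

text \<open>The substitution \<open>m = a + b\<close>, \<open>n = a - b\<close> identifies all integer pairs \<open>(a, b)\<close> with the pairs
  \<open>(m, n)\<close> of even sum, and turns \<open>m\<^sup>2 + n\<^sup>2\<close> into \<open>2 (a\<^sup>2 + b\<^sup>2)\<close>. This is how products of theta values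
  at \<open>\<plusminus>q\<close> become squares of theta values at \<open>\<plusminus>q\<^sup>2\<close>.\<close>

lemma has_sum_rotate_even_lattice:
  fixes f :: "int \<times> int \<Rightarrow> real"
  assumes odd: "\<And>m n. odd (m + n) \<Longrightarrow> f (m, n) = 0"
    and f: "(f has_sum S) UNIV"
  shows "((\<lambda>(a, b). f (a + b, a - b)) has_sum S) UNIV"
proof -
  define E where "E = {(m, n :: int). even (m + n)}"
  have "bij_betw (\<lambda>(a, b). (a + b, a - b)) UNIV E"
  proof (rule bij_betwI')
    show "\<exists>p\<in>UNIV. e = (case p of (a, b) \<Rightarrow> (a + b, a - b))" if in_E: "e \<in> E" for e
    proof -
      obtain m n where e: "e = (m, n)" "even (m + n)"
        using in_E unfolding E_def by blast
      from e(2) obtain k where "m + n = 2 * k"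
        by (rule evenE)
      then have "e = (k + (m - k), k - (m - k))"
        using e(1) by simp
      then have "e = (case (k, m - k) of (a, b) \<Rightarrow> (a + b, a - b))"
        by simp
      then show ?thesis
        by blast
    qed
  qed (auto simp: E_def)
  moreover have "(f has_sum S) E"
    using f by (rule has_sum_cong_neutral[THEN iffD1, rotated -1]) (use odd in \<open>auto simp: E_def\<close>)
  ultimately have "((\<lambda>p. f (case p of (a, b) \<Rightarrow> (a + b, a - b))) has_sum S) UNIV"
    using has_sum_reindex_bij_betw by blast
  then show ?thesis
    by (simp add: case_prod_unfold)
qed

lemma powi_add_nonneg:
  fixes q :: real
  assumes "0 \<le> i" "0 \<le> j"
  shows "q powi i * q powi j = q powi (i + j)"
  using assms by (simp add: power_int_nonneg_exp nat_add_distrib power_add)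

lemma powi_uminus:
  fixes q :: real
  shows "(- q) powi i = (if even i then q powi i else - (q powi i))"
  by (auto simp: power_int_minus_left)

lemma rotated_squares: "(a + b)\<^sup>2 + (a - b)\<^sup>2 = 2 * (a\<^sup>2 + b\<^sup>2)" for a b :: int
  by (simp add: power2_eq_square algebra_simps)

text \<open>In the double series of \<open>\<theta>\<^sup>2(q) + \<theta>\<^sup>2(-q)\<close> the term at \<open>(m, n)\<close> is the sum of the powers of \<open>q\<close> and \<open>-q\<close>
  with exponent \<open>m\<^sup>2 + n\<^sup>2\<close>, so it vanishes when \<open>m + n\<close> is odd and doubles when it is even.\<close>

lemma theta_square_mean:
  assumes "\<bar>q\<bar> < 1"
  shows "(theta q)\<^sup>2 + (theta (- q))\<^sup>2 = 2 * (theta (q\<^sup>2))\<^sup>2"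
proof -
  define f where "f = (\<lambda>(m::int, n::int).
    q powi (m\<^sup>2) * q powi (n\<^sup>2) + (- q) powi (m\<^sup>2) * (- q) powi (n\<^sup>2))"
  have "(f has_sum theta q * theta q + theta (- q) * theta (- q)) UNIV"
    using has_sum_add[OF theta_product_has_sum theta_product_has_sum, of q q "- q" "- q"] assms
    by (simp add: f_def case_prod_unfold)
  moreover have "f (m, n) = 0" if "odd (m + n)" for m n
    using that by (auto simp: f_def powi_uminus)
  ultimately have "((\<lambda>(a, b). f (a + b, a - b)) has_sum
      theta q * theta q + theta (- q) * theta (- q)) UNIV"
    by (intro has_sum_rotate_even_lattice)
  moreover have "f (a + b, a - b) = 2 * ((q\<^sup>2) powi (a\<^sup>2) * (q\<^sup>2) powi (b\<^sup>2))" for a b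
  proof -
    have "f (a + b, a - b) = 2 * q powi (2 * (a\<^sup>2 + b\<^sup>2))"
      by (simp add: f_def powi_add_nonneg rotated_squares powi_uminus)
    also have "q powi (2 * (a\<^sup>2 + b\<^sup>2)) = (q\<^sup>2) powi (a\<^sup>2) * (q\<^sup>2) powi (b\<^sup>2)"
      unfolding power_int_mult by (simp add: powi_add_nonneg)
    finally show ?thesis .
  qed
  ultimately have "((\<lambda>(a, b). 2 * ((q\<^sup>2) powi (a\<^sup>2) * (q\<^sup>2) powi (b\<^sup>2))) has_sum
      theta q * theta q + theta (- q) * theta (- q)) (UNIV :: (int \<times> int) set)"
    by simp
  moreover have "((\<lambda>(a, b). 2 * ((q\<^sup>2) powi (a\<^sup>2) * (q\<^sup>2) powi (b\<^sup>2))) has_sum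
      2 * (theta (q\<^sup>2) * theta (q\<^sup>2))) (UNIV :: (int \<times> int) set)"
    using has_sum_cmult_right[OF theta_product_has_sum, of "q\<^sup>2" "q\<^sup>2" 2] assms
    by (simp add: case_prod_unfold abs_square_less_1)
  ultimately show ?thesis
    unfolding power2_eq_square by (rule has_sum_unique)
qed

text \<open>A single product \<open>\<theta>(q) \<theta>(-q)\<close> also has terms with \<open>m + n\<close> odd; they cancel against their
  mirror images under \<open>(m, n) \<mapsto> (n, m)\<close>. Adding the product with its factors exchanged makes the
  cancellation happen termwise, at the price of a factor 2. On the remaining terms the sign is
  the parity of \<open>a + b\<close>, which is that of \<open>a\<^sup>2 + b\<^sup>2\<close>.\<close>

lemma theta_product_reflection:
  assumes "\<bar>q\<bar> < 1"
  shows "theta q * theta (- q) = (theta (- (q\<^sup>2)))\<^sup>2"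
proof -
  define f where "f = (\<lambda>(m::int, n::int).
    q powi (m\<^sup>2) * (- q) powi (n\<^sup>2) + (- q) powi (m\<^sup>2) * q powi (n\<^sup>2))"
  have "(f has_sum theta q * theta (- q) + theta (- q) * theta q) UNIV"
    using has_sum_add[OF theta_product_has_sum theta_product_has_sum, of q "- q" "- q" q] assms
    by (simp add: f_def case_prod_unfold)
  moreover have "f (m, n) = 0" if "odd (m + n)" for m n
    using that by (auto simp: f_def powi_uminus)
  ultimately have "((\<lambda>(a, b). f (a + b, a - b)) has_sum
      theta q * theta (- q) + theta (- q) * theta q) UNIV"
    by (intro has_sum_rotate_even_lattice)
  moreover have "f (a + b, a - b) = 2 * ((- (q\<^sup>2)) powi (a\<^sup>2) * (- (q\<^sup>2)) powi (b\<^sup>2))" for a b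
  proof -
    have "f (a + b, a - b) = (if even (a + b) then 2 else - 2) * q powi (2 * (a\<^sup>2 + b\<^sup>2))"
      by (simp add: f_def powi_add_nonneg rotated_squares powi_uminus)
    also have "q powi (2 * (a\<^sup>2 + b\<^sup>2)) = (q\<^sup>2) powi (a\<^sup>2 + b\<^sup>2)"
      unfolding power_int_mult by simp
    also have "(if even (a + b) then 2 else - 2) * (q\<^sup>2) powi (a\<^sup>2 + b\<^sup>2)
        = 2 * (- (q\<^sup>2)) powi (a\<^sup>2 + b\<^sup>2)"
      unfolding powi_uminus by simp
    also have "(- (q\<^sup>2)) powi (a\<^sup>2 + b\<^sup>2) = (- (q\<^sup>2)) powi (a\<^sup>2) * (- (q\<^sup>2)) powi (b\<^sup>2)"
      by (rule powi_add_nonneg[symmetric]) simp_all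
    finally show ?thesis .
  qed
  ultimately have "((\<lambda>(a, b). 2 * ((- (q\<^sup>2)) powi (a\<^sup>2) * (- (q\<^sup>2)) powi (b\<^sup>2))) has_sum
      theta q * theta (- q) + theta (- q) * theta q) (UNIV :: (int \<times> int) set)"
    by simp
  moreover have "((\<lambda>(a, b). 2 * ((- (q\<^sup>2)) powi (a\<^sup>2) * (- (q\<^sup>2)) powi (b\<^sup>2))) has_sum
      2 * (theta (- (q\<^sup>2)) * theta (- (q\<^sup>2)))) (UNIV :: (int \<times> int) set)"
    using has_sum_cmult_right[OF theta_product_has_sum, of "- (q\<^sup>2)" "- (q\<^sup>2)" 2] assms
    by (simp add: case_prod_unfold abs_square_less_1)
  ultimately have "theta q * theta (- q) + theta (- q) * theta q
      = 2 * (theta (- (q\<^sup>2)) * theta (- (q\<^sup>2)))"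
    by (rule has_sum_unique)
  then show ?thesis
    by (simp add: power2_eq_square)
qed

lemma theta_0: "theta 0 = 1"
proof -
  have "((\<lambda>n::int. 0 powi (n\<^sup>2) :: real) has_sum (\<Sum>n\<in>{0::int}. 0 powi (n\<^sup>2))) {0}"
    by (rule has_sum_finite) simp
  then have "((\<lambda>n::int. 0 powi (n\<^sup>2) :: real) has_sum 1) UNIV"
    by (subst has_sum_cong_neutral[where T = "{0}"]) (auto simp: power_int_0_left_if)
  then show ?thesis
    unfolding theta_def by (rule infsumI)
qed

text \<open>The series converges uniformly on each \<open>[-r, r]\<close> with \<open>r < 1\<close>, by comparison with its value at
  \<open>r\<close>.\<close>

lemma theta_continuous: "continuous_on {-1<..<1} theta"
proof -
  have piece: "continuous_on {-r..r} theta" if "0 \<le> r" "r < 1" for r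
  proof (rule uniform_limit_theorem)
    show "uniform_limit {-r..r} (\<lambda>X q. \<Sum>n\<in>X. q powi (n\<^sup>2)) theta
        (finite_subsets_at_top (UNIV :: int set))"
    proof (rule Weierstrass_m_test_general')
      show "norm (q powi (n\<^sup>2)) \<le> r powi (n\<^sup>2)" if "q \<in> {-r..r}" for n :: int and q
        using that by (auto simp: power_int_nonneg_exp power_abs intro!: power_mono)
      show "((\<lambda>n::int. q powi (n\<^sup>2)) has_sum theta q) UNIV" if "q \<in> {-r..r}" for q
        using that \<open>r < 1\<close> by (intro theta_has_sum) auto
      show "(\<lambda>n::int. r powi (n\<^sup>2)) summable_on UNIV"
        using \<open>0 \<le> r\<close> \<open>r < 1\<close> by (rule theta_summable_nonneg)
    qed
    show "\<forall>\<^sub>F X in finite_subsets_at_top (UNIV :: int set).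
        continuous_on {-r..r} (\<lambda>q. \<Sum>n\<in>X. q powi (n\<^sup>2))"
      by (auto intro!: always_eventually continuous_intros simp: power_int_nonneg_exp)
  qed simp
  have "isCont theta q" if "q \<in> {-1<..<1}" for q
  proof -
    define r where "r = (1 + \<bar>q\<bar>) / 2"
    have "0 \<le> r" "r < 1" "-r < q" "q < r"
      using that by (auto simp: r_def abs_if field_simps)
    then show ?thesis
      using piece continuous_on_interior[of "{-r..r}" theta q] by simp
  qed
  then show ?thesis
    by (simp add: continuous_at_imp_continuous_on)
qed

lemma theta_strict_mono_nonneg:
  assumes "0 \<le> q" "q < r" "r < 1"
  shows "theta q < theta r"
proof (rule has_sum_strict_mono)
  show "((\<lambda>n::int. q powi (n\<^sup>2)) has_sum theta q) UNIV"
    and "((\<lambda>n::int. r powi (n\<^sup>2)) has_sum theta r) UNIV"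
    using assms by (intro theta_has_sum; simp)+
  show "q powi (n\<^sup>2) \<le> r powi (n\<^sup>2)" for n :: int
    using assms by (simp add: power_int_nonneg_exp power_mono)
  show "q powi ((1::int)\<^sup>2) < r powi (1\<^sup>2)"
    using assms by simp
qed simp

lemma theta_ge_1:
  assumes "0 \<le> q" "q < 1"
  shows "theta q \<ge> 1"
  using theta_strict_mono_nonneg[of 0 q] theta_0 assms by (cases "q = 0") auto

lemma square_power_tendsto_0:
  fixes q :: real
  assumes "\<bar>q\<bar> < 1"
  shows "(\<lambda>n. q ^ (2 ^ n)) \<longlonglongrightarrow> 0"
proof -
  have "strict_mono (\<lambda>n. 2 ^ n :: nat)"
    by (simp add: strict_mono_def)
  from LIMSEQ_subseq_LIMSEQ[OF LIMSEQ_power_zero this, of q] show ?thesis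
    using assms by (simp add: o_def)
qed

text \<open>On negative arguments, \<open>\<theta>(-q) = \<theta>\<^sup>2(-q\<^sup>2) / \<theta>(q)\<close> shows nonnegativity. A zero at \<open>-q\<close> would
  propagate to \<open>-q\<^sup>2, -q\<^sup>4, \<dots>\<close>, which tend to \<open>0\<close>, contradicting \<open>\<theta>(0) = 1\<close> and continuity.\<close>

lemma theta_pos:
  assumes "\<bar>q\<bar> < 1"
  shows "theta q > 0"
proof -
  have "theta (- q) > 0" if "0 \<le> q" "q < 1" for q
  proof -
    have lt1: "0 \<le> q ^ (2 ^ n) \<and> q ^ (2 ^ n) < 1" for n
      using that by (simp add: power_less_one_iff)
    have step: "theta (- r) = (theta (- (r\<^sup>2)))\<^sup>2 / theta r" if "0 \<le> r" "r < 1" for r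
      using theta_product_reflection[of r] theta_ge_1[of r] that by (simp add: field_simps)
    have "theta (- q) \<noteq> 0"
    proof
      assume zero: "theta (- q) = 0"
      have "theta (- (q ^ (2 ^ n))) = 0" for n
      proof (induction n)
        case (Suc n)
        have "q ^ (2 ^ Suc n) = (q ^ (2 ^ n))\<^sup>2"
          by (simp only: power_mult[symmetric] power_Suc mult.commute)
        then show ?case
          using Suc theta_product_reflection[of "q ^ (2 ^ n)"] lt1[of n] by simp
      qed (simp add: zero)
      moreover have "(\<lambda>n. theta (- (q ^ (2 ^ n)))) \<longlonglongrightarrow> theta 0"
      proof (rule isCont_tendsto_compose[where g = theta])
        show "isCont theta 0"
          using theta_continuous by (simp add: continuous_on_eq_continuous_at)
        show "(\<lambda>n. - (q ^ (2 ^ n))) \<longlonglongrightarrow> 0"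
          using tendsto_minus[OF square_power_tendsto_0[of q]] that by simp
      qed
      ultimately show False
        by (simp add: theta_0 LIMSEQ_const_iff)
    qed
    moreover have "theta (- q) \<ge> 0"
      using step[OF that] theta_ge_1[OF that] by simp
    ultimately show ?thesis
      by simp
  qed
  from this[of "- q"] theta_ge_1[of q] show ?thesis
    using assms by (cases "q \<ge> 0") auto
qed

text \<open>The iteration started at \<open>\<theta>\<^sup>2(q)\<close>, \<open>\<theta>\<^sup>2(-q)\<close> runs through the same pair at the nomes
  \<open>q\<^sup>2, q\<^sup>4, q\<^sup>8, \<dots>\<close>.\<close>

lemma agm_theta:
  assumes "\<bar>q\<bar> < 1"
  shows "agm ((theta q)\<^sup>2) ((theta (- q))\<^sup>2) = 1"
proof -
  have lt1: "\<bar>q ^ (2 ^ n)\<bar> < 1" for n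
  proof -
    have "\<bar>q\<bar> ^ (2 ^ n) < 1 ^ (2 ^ n)"
      by (rule power_strict_mono) (use assms in auto)
    then show ?thesis
      by (simp only: power_abs power_one)
  qed
  have "agm_seq ((theta q)\<^sup>2) ((theta (- q))\<^sup>2) n
      = ((theta (q ^ (2 ^ n)))\<^sup>2, (theta (- (q ^ (2 ^ n))))\<^sup>2)" for n
  proof (induction n)
    case (Suc n)
    define r where "r = q ^ (2 ^ n)"
    have r: "\<bar>r\<bar> < 1"
      unfolding r_def by (rule lt1)
    have square: "q ^ (2 ^ Suc n) = r\<^sup>2"
      unfolding r_def by (simp only: power_mult[symmetric] power_Suc mult.commute)
    have "(theta r)\<^sup>2 * (theta (- r))\<^sup>2 = ((theta (- (r\<^sup>2)))\<^sup>2)\<^sup>2"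
      using theta_product_reflection[OF r] by (metis power_mult_distrib)
    then have geometric: "sqrt ((theta r)\<^sup>2 * (theta (- r))\<^sup>2) = (theta (- (r\<^sup>2)))\<^sup>2"
      by (simp only: real_sqrt_abs abs_power2)
    have arithmetic: "((theta r)\<^sup>2 + (theta (- r))\<^sup>2) / 2 = (theta (r\<^sup>2))\<^sup>2"
      using theta_square_mean[OF r] by simp
    show ?case
      unfolding agm_seq.simps(2) Suc fst_conv snd_conv square r_def[symmetric] geometric arithmetic ..
  qed simp
  moreover have "(\<lambda>n. (theta (q ^ (2 ^ n)))\<^sup>2) \<longlonglongrightarrow> (theta 0)\<^sup>2"
  proof (intro tendsto_power isCont_tendsto_compose[where g = theta])
    show "isCont theta 0"
      using theta_continuous by (simp add: continuous_on_eq_continuous_at)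
  qed (rule square_power_tendsto_0[OF assms])
  ultimately show ?thesis
    unfolding agm_def by (intro limI) (simp add: theta_0)
qed

text \<open>Otherwise, between \<open>q\<close> and \<open>r\<close>, the first argument of the \<open>agm\<close> in \<open>agm_theta\<close> would grow and
  the second would not shrink, while the value stays \<open>1\<close>.\<close>

lemma theta_reflect_strict_antimono:
  assumes "0 \<le> q" "q < r" "r < 1"
  shows "theta (- r) < theta (- q)"
proof (rule ccontr)
  assume "\<not> theta (- r) < theta (- q)"
  then have "(theta (- q))\<^sup>2 \<le> (theta (- r))\<^sup>2"
    using theta_pos[of "- q"] assms by (intro power_mono) simp_all
  moreover have "(theta q)\<^sup>2 < (theta r)\<^sup>2"
    using theta_strict_mono_nonneg[OF assms] theta_pos[of q] assms by (intro power_strict_mono) simp_all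
  moreover have "0 < (theta q)\<^sup>2" "0 < (theta (- q))\<^sup>2"
    using theta_pos[of q] theta_pos[of "- q"] assms by simp_all
  ultimately have "agm ((theta q)\<^sup>2) ((theta (- q))\<^sup>2) < agm ((theta r)\<^sup>2) ((theta (- r))\<^sup>2)"
    by (intro agm_strict_mono) simp_all
  then show False
    using assms by (simp add: agm_theta)
qed

lemma theta_strict_mono:
  assumes "-1 < q" "q < r" "r < 1"
  shows "theta q < theta r"
proof (cases "0 \<le> q")
  case True
  then show ?thesis
    using assms by (intro theta_strict_mono_nonneg)
next
  case False
  show ?thesis
  proof (cases "r \<le> 0")
    case True
    then show ?thesis
      using theta_reflect_strict_antimono[of "- r" "- q"] assms by simp
  next
    case False
    have "theta q < theta 0"
      using theta_reflect_strict_antimono[of 0 "- q"] assms \<open>\<not> 0 \<le> q\<close> by simp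
    also have "\<dots> < theta r"
      using theta_strict_mono_nonneg[of 0 r] assms False by simp
    finally show ?thesis .
  qed
qed

text \<open>As \<open>q\<close> tends to \<open>1\<close>, any \<open>N\<close> terms of the series have sum tending to \<open>N\<close>.\<close>

lemma theta_unbounded:
  fixes B :: real
  obtains q where "0 \<le> q" "q < 1" "theta q > B"
proof -
  obtain N :: nat where N: "B + 1 < real N"
    using reals_Archimedean2 by blast
  define S where "S = int ` {..<N}"
  have "(\<lambda>q::real. \<Sum>n\<in>S. q ^ nat (n\<^sup>2)) \<midarrow>1\<rightarrow> (\<Sum>n\<in>S. 1 ^ nat (n\<^sup>2))"
    by (intro tendsto_intros)
  moreover have "(\<Sum>n\<in>S. 1 ^ nat (n\<^sup>2)) = real N"
    by (simp add: S_def card_image)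
  ultimately have "((\<lambda>q::real. \<Sum>n\<in>S. q ^ nat (n\<^sup>2)) \<longlongrightarrow> real N) (at_left 1)"
    by (simp add: filterlim_at_split)
  then have "\<forall>\<^sub>F q::real in at_left 1. B < (\<Sum>n\<in>S. q ^ nat (n\<^sup>2))"
    using N by (intro order_tendstoD(1)[where y = "real N"]) simp_all
  moreover have "\<forall>\<^sub>F q::real in at_left 1. q \<in> {0<..<1}"
    by (rule eventually_at_leftI[of 0]) simp_all
  ultimately have "\<forall>\<^sub>F q::real in at_left 1. q \<in> {0<..<1} \<and> B < (\<Sum>n\<in>S. q ^ nat (n\<^sup>2))"
    by (simp add: eventually_conj_iff)
  then obtain q :: real where q: "0 < q" "q < 1" "B < (\<Sum>n\<in>S. q ^ nat (n\<^sup>2))"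
    using eventually_happens[of _ "at_left (1::real)"] by (auto simp: trivial_limit_at_left_real)
  have "(\<Sum>n\<in>S. q powi (n\<^sup>2)) \<le> theta q"
    using q by (intro finite_sum_le_has_sum[OF theta_has_sum]) (simp_all add: S_def)
  then have "B < theta q"
    using q by (simp add: power_int_nonneg_exp)
  then show thesis
    using that[of q] q by simp
qed

text \<open>Choosing \<open>u\<close> with \<open>\<theta>(u)\<close> above both \<open>t\<close> and \<open>1/t\<close> puts \<open>t\<close> between \<open>\<theta>(-u) \<le> 1/\<theta>(u)\<close> and
  \<open>\<theta>(u)\<close>, so that the intermediate value theorem applies.\<close>

lemma theta_surj:
  assumes "t > 0"
  obtains q where "-1 < q" "q < 1" "theta q = t"
proof -
  obtain u where u: "0 \<le> u" "u < 1" "theta u > max t (1 / t)"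
    by (rule theta_unbounded)
  have "theta u * theta (- u) \<le> 1"
  proof -
    have "theta (- (u\<^sup>2)) \<le> 1"
      using theta_reflect_strict_antimono[of 0 "u\<^sup>2"] u
      by (cases "u = 0") (auto simp: theta_0 abs_square_less_1)
    then have "(theta (- (u\<^sup>2)))\<^sup>2 \<le> 1"
      using theta_pos[of "- (u\<^sup>2)"] u by (simp add: abs_square_less_1 power_le_one)
    then show ?thesis
      using theta_product_reflection[of u] u by simp
  qed
  then have "theta (- u) \<le> 1 / theta u"
    using theta_pos[of u] u by (simp add: field_simps)
  also have "\<dots> \<le> t"
    using u assms theta_pos[of u] by (simp add: field_simps)
  finally have "\<exists>q\<ge>- u. q \<le> u \<and> theta q = t"
    using u by (intro IVT' continuous_on_subset[OF theta_continuous]) auto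
  then obtain q where "- u \<le> q" "q \<le> u" "theta q = t"
    by blast
  then show thesis
    using u by (intro that[of q]) simp_all
qed

section \<open>The operation in terms of the arithmetic-geometric mean\<close>

lemma nome_spec:
  assumes "x > 0" "y > 0"
  shows "\<bar>nome x y\<bar> < 1" and "1 / agm x y = (theta (nome x y))\<^sup>2"
proof -
  have pos: "1 / agm x y > 0"
    using agm_limit(2)[OF assms] by simp
  obtain q where q: "-1 < q" "q < 1" "theta q = sqrt (1 / agm x y)"
    using theta_surj[of "sqrt (1 / agm x y)"] pos by auto
  have "\<exists>!q. q \<in> {-1<..<1} \<and> 1 / agm x y = (theta q)\<^sup>2"
  proof (rule ex1I)
    show "q \<in> {-1<..<1} \<and> 1 / agm x y = (theta q)\<^sup>2"
      using q pos by simp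
    fix r assume r: "r \<in> {-1<..<1} \<and> 1 / agm x y = (theta r)\<^sup>2"
    then have "theta r > 0"
      by (intro theta_pos) auto
    then have "theta r = theta q"
      using q r by simp
    moreover have "theta r \<noteq> theta q" if "r < q"
      using theta_strict_mono[of r q] that r q(2) by simp
    moreover have "theta r \<noteq> theta q" if "q < r"
      using theta_strict_mono[of q r] that r q(1) by simp
    ultimately show "r = q"
      by (metis linorder_neqE)
  qed
  from theI'[OF this] show "\<bar>nome x y\<bar> < 1" and "1 / agm x y = (theta (nome x y))\<^sup>2"
    unfolding nome_def[symmetric] by auto
qed

lemma star_pos:
  assumes "x > 0" "y > 0"
  shows "x \<star> y > 0"
  using theta_pos[of "nome x y"] theta_pos[of "- nome x y"] nome_spec(1)[OF assms]
  by (simp add: star_def)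

text \<open>The bridge from theta functions to the arithmetic-geometric mean: scaling the pair
  \<open>(1, x \<star> y)\<close> by \<open>\<theta>\<^sup>2(q)\<close> gives the pair of \<open>agm_theta\<close>.\<close>

lemma agm_1_star:
  assumes "x > 0" "y > 0"
  shows "agm 1 (x \<star> y) = agm x y"
proof -
  define q where "q = nome x y"
  have q: "\<bar>q\<bar> < 1" "1 / agm x y = (theta q)\<^sup>2"
    using nome_spec[OF assms] by (simp_all add: q_def)
  have pos: "(theta q)\<^sup>2 > 0"
    using theta_pos[of q] q(1) by simp
  have "(theta q)\<^sup>2 * agm 1 (x \<star> y) = agm ((theta q)\<^sup>2 * 1) ((theta q)\<^sup>2 * (x \<star> y))"
    using pos star_pos[OF assms] by (simp only: agm_scale zero_less_one)
  also have "\<dots> = agm ((theta q)\<^sup>2) ((theta (- q))\<^sup>2)"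
    using pos by (simp add: star_def flip: q_def)
  also have "\<dots> = 1"
    by (rule agm_theta[OF q(1)])
  finally show ?thesis
    using q(2) pos by (metis nonzero_mult_div_cancel_left less_irrefl divide_divide_eq_right div_by_1 mult_1)
qed

lemma star_eq_iff:
  assumes "x > 0" "y > 0" "z > 0"
  shows "x \<star> y = z \<longleftrightarrow> agm 1 z = agm x y"
  using agm_1_star[OF assms(1,2)] agm_right_cancel[of 1 "x \<star> y" z] star_pos[OF assms(1,2)] assms(3)
  by auto

lemma star_left_cancel:
  assumes "a > 0" "x > 0" "y > 0" "a \<star> x = a \<star> y"
  shows "x = y"
proof (rule agm_right_cancel)
  show "agm a x = agm a y"
    using assms by (metis agm_1_star)
qed (use assms in simp_all)

lemma star_distrib:
  assumes "a > 0" "x > 0" "y > 0"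
  shows "(a * x) \<star> (a * y) = a \<star> (a * (x \<star> y))"
proof -
  have pos: "x \<star> y > 0" "a * (x \<star> y) > 0"
    using assms star_pos by simp_all
  have "agm 1 (a \<star> (a * (x \<star> y))) = agm (a * 1) (a * (x \<star> y))"
    using assms pos by (simp add: agm_1_star)
  also have "\<dots> = a * agm 1 (x \<star> y)"
    using assms pos by (intro agm_scale) simp_all
  also have "\<dots> = agm (a * x) (a * y)"
    using assms by (simp add: agm_1_star agm_scale)
  finally show ?thesis
    using assms pos by (simp add: star_eq_iff star_pos)
qed

text \<open>Dividing by \<open>x\<close> turns the unknown \<open>y\<close> from an argument of \<open>\<star>\<close> into its value: both equations
  say that \<open>agm 1 z = agm x y\<close>.\<close>

lemma star_solve:
  assumes "x > 0" "y > 0" "z > 0"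
  shows "x \<star> y = z \<longleftrightarrow> y = x * (inverse x \<star> (inverse x * z))"
proof -
  have "agm 1 (inverse x * y) = agm (inverse x * x) (inverse x * y)"
    using assms by simp
  also have "\<dots> = inverse x * agm x y"
    using assms by (intro agm_scale) simp_all
  finally have y: "agm 1 (inverse x * y) = inverse x * agm x y" .
  have "agm (inverse x * 1) (inverse x * z) = inverse x * agm 1 z"
    using assms by (intro agm_scale) simp_all
  then have z: "agm (inverse x) (inverse x * z) = inverse x * agm 1 z"
    by simp
  have "x \<star> y = z \<longleftrightarrow> agm 1 (inverse x * y) = agm (inverse x) (inverse x * z)"
    using assms by (simp add: star_eq_iff y z) auto
  also have "\<dots> \<longleftrightarrow> inverse x \<star> (inverse x * z) = inverse x * y"
    using assms by (simp add: star_eq_iff)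
  also have "\<dots> \<longleftrightarrow> y = x * (inverse x \<star> (inverse x * z))"
    using assms by (auto simp: field_simps)
  finally show ?thesis .
qed

lemma star_inverse_iff:
  assumes "x > 0"
  shows "star_inverse x y \<longleftrightarrow> y = x * (inverse x \<star> inverse x)"
proof
  assume "star_inverse x y"
  then show "y = x * (inverse x \<star> inverse x)"
    using star_solve[of x y 1] assms by (simp add: star_inverse_def)
next
  assume y: "y = x * (inverse x \<star> inverse x)"
  then have "y > 0"
    using assms star_pos[of "inverse x" "inverse x"] by simp
  then show "star_inverse x y"
    using star_solve[of x y 1] assms y by (simp add: star_inverse_def)
qed

theorem theorem2:
  shows "(\<forall>a x y::real. a > 0 \<longrightarrow> x > 0 \<longrightarrow> y > 0 \<longrightarrow> a \<star> x = a \<star> y \<longrightarrow> x = y)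
    \<and> (\<forall>a x y::real. a > 0 \<longrightarrow> x > 0 \<longrightarrow> y > 0 \<longrightarrow>
          (a * x) \<star> (a * y) = a \<star> (a * (x \<star> y)))
    \<and> (\<forall>x y z::real. x > 0 \<longrightarrow> y > 0 \<longrightarrow> z = x \<star> y \<longrightarrow>
          y = x * (inverse x \<star> (inverse x * z)))
    \<and> (\<forall>x y::real. x > 0 \<longrightarrow> (star_inverse x y \<longleftrightarrow> y = x * (inverse x \<star> inverse x)))"
proof (intro conjI allI impI)
  fix a x y :: real
  assume "a > 0" "x > 0" "y > 0" "a \<star> x = a \<star> y"
  then show "x = y"
    by (rule star_left_cancel)
next
  fix a x y :: real
  assume "a > 0" "x > 0" "y > 0"
  then show "(a * x) \<star> (a * y) = a \<star> (a * (x \<star> y))"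
    by (rule star_distrib)
next
  fix x y z :: real
  assume "x > 0" "y > 0" "z = x \<star> y"
  then show "y = x * (inverse x \<star> (inverse x * z))"
    using star_solve[of x y z] star_pos by simp
next
  fix x y :: real
  assume "x > 0"
  then show "star_inverse x y \<longleftrightarrow> y = x * (inverse x \<star> inverse x)"
    by (rule star_inverse_iff)
qed

end
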